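(* Let $(X,\|\cdot\|)$ be a normed vector lattice, let $T\subseteq X$ and $t_0\in T$. For $t\in T$, $t\neq t_0$, put $d_t=(t-t_0)/\|t-t_0\|$, and let $D_0=\{d_t:t\in T,\ t\ne t_0\}$. Suppose that there exist $q,C_0\ge1$ and $\varepsilon_0>0$ such that $$N_{[]}(D_0,\varepsilon)\le\bigg(\frac{C_0}{\varepsilon}\bigg)^q\qquad\text{for every }0<\varepsilon\le\varepsilon_0.$$ Choose any $d\in X$ such that $|d_t|\le d$ for all $t\in T$, $t\neq t_0$. Then $$N_{[]}(T\cap B(t_0,\delta),\rho)\le\bigg(\frac{8C\delta}{\rho}\bigg)^{q+1}$$ for all $\delta,\rho>0$ such that $\rho/\delta<\min(4,2\|d\|)$, where $C=C_0\max\big(1,\|d\|/(4\varepsilon_0)\big)$.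
   Context: A normed vector lattice (normed Riesz space) is a vector lattice with a norm satisfying $\|x\|\le\|y\|$ whenever $|x|\le|y|$. $B(t_0,\delta)=\{x\in X:\|x-t_0\|\le\delta\}$. For $S\subseteq X$ and $\varepsilon>0$, the bracketing number $N_{[]}(S,\varepsilon)$ is the smallest $n$ for which there exist $l_i,u_i\in X$, $i=1,\ldots,n$, with $\|u_i-l_i\|\le\varepsilon$ and $S\subseteq\bigcup_{i=1}^n[l_i,u_i]$, where $[l,u]=\{x\in X:l\le x\le u\}$ (infinite if no such $n$ exists). *)

theory Defs
  imports
    "HOL-Analysis.Analysis"
    "HOL-Library.Lattice_Algebras"
    "HOL-Library.Extended_Real"
begin

class normed_vector_lattice =
  real_normed_vector + ordered_real_vector + lattice_ab_group_add_abs +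
  assumes norm_le_norm_if_abs_le_abs: "\<bar>x\<bar> \<le> \<bar>y\<bar> \<Longrightarrow> norm x \<le> norm y"

(* The infimum of the empty set in enat is \<infinity>.  The empty family (n = 0) is admitted,
   so the bracketing number of the empty set is 0. *)
definition bracketing_number :: "'a::normed_vector_lattice set \<Rightarrow> real \<Rightarrow> enat" where
  "bracketing_number S \<epsilon> =
     (INF n \<in> {n. \<exists>l u :: nat \<Rightarrow> 'a.
                 (\<forall>i\<in>{1..n}. norm (u i - l i) \<le> \<epsilon>) \<and> S \<subseteq> (\<Union>i\<in>{1..n}. {l i..u i})}.
        enat n)"

definition direction :: "'a::real_normed_vector \<Rightarrow> 'a \<Rightarrow> 'a" where
  "direction t0 t = (t - t0) /\<^sub>R norm (t - t0)"

end

theory Submission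
  imports Defs
begin

text \<open>
  Every \<open>t\<close> in \<open>T \<inter> B(t\<^sub>0,\<delta>)\<close> is \<open>t\<^sub>0 + r e\<close> with \<open>0 \<le> r \<le> \<delta>\<close> and \<open>e \<in> D\<^sub>0\<close>. Cut
  \<open>[0,\<delta>]\<close> into \<open>K\<close> intervals of length \<open>\<eta>\<close> with midpoints \<open>m\<close>; since \<open>\<bar>e\<bar> \<le> d\<close>, an \<open>\<epsilon>\<close>-bracket
  \<open>[l,u]\<close> of \<open>e\<close> gives the bracket \<open>[m l - (\<eta>/2) d, m u + (\<eta>/2) d]\<close> of \<open>r e\<close>, of size at most
  \<open>\<delta> \<epsilon> + \<eta> \<parallel>d\<parallel>\<close>. Take \<open>\<epsilon> = min(\<rho>/(2\<delta>), \<epsilon>\<^sub>0)\<close> and \<open>K = \<lceil>2\<delta>\<parallel>d\<parallel>/\<rho>\<rceil>\<close>. If \<open>D\<^sub>0\<close> is nonempty,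
  then \<open>1 \<le> N(D\<^sub>0,\<epsilon>\<^sub>0) \<le> (C\<^sub>0/\<epsilon>\<^sub>0)\<^sup>q\<close> forces \<open>\<epsilon>\<^sub>0 \<le> C\<^sub>0\<close>, hence \<open>\<parallel>d\<parallel> \<le> 4C\<close>, which absorbs the
  factor \<open>K\<close>.
\<close>

lemma bracketing_number_le_card:
  fixes S :: "'a::normed_vector_lattice set"
  assumes "finite I" and width: "\<And>i. i \<in> I \<Longrightarrow> norm (u i - l i) \<le> \<epsilon>"
    and cover: "S \<subseteq> (\<Union>i\<in>I. {l i..u i})"
  shows "bracketing_number S \<epsilon> \<le> enat (card I)"
proof -
  obtain f where f: "bij_betw f {1..card I} I"
    using ex_bij_betw_nat_finite_1[OF \<open>finite I\<close>] by blast
  then have im: "f ` {1..card I} = I"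
    by (simp add: bij_betw_def)
  have "S \<subseteq> (\<Union>i\<in>f ` {1..card I}. {l i..u i})"
    unfolding im by (rule cover)
  then have "S \<subseteq> (\<Union>i\<in>{1..card I}. {(l \<circ> f) i..(u \<circ> f) i})"
    by simp
  moreover have "\<forall>i\<in>{1..card I}. norm ((u \<circ> f) i - (l \<circ> f) i) \<le> \<epsilon>"
    using width im by auto
  ultimately show ?thesis
    unfolding bracketing_number_def by (intro INF_lower) blast
qed

text \<open>A finite bound rules out the infimum over the empty set, which is \<infinity>, and a
  nonempty subset of the well-ordered \<open>enat\<close> attains its infimum. So a minimal family
  of brackets really exists.\<close>

lemma bracketing_number_leE:
  fixes S :: "'a::normed_vector_lattice set"
  assumes "ereal_of_enat (bracketing_number S \<epsilon>) \<le> ereal c"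
  obtains n and l u :: "nat \<Rightarrow> 'a" where "real n \<le> c"
    and "\<And>i. i \<in> {1..n} \<Longrightarrow> norm (u i - l i) \<le> \<epsilon>"
    and "S \<subseteq> (\<Union>i\<in>{1..n}. {l i..u i})"
proof -
  define A where "A = {n. \<exists>l u :: nat \<Rightarrow> 'a.
    (\<forall>i\<in>{1..n}. norm (u i - l i) \<le> \<epsilon>) \<and> S \<subseteq> (\<Union>i\<in>{1..n}. {l i..u i})}"
  have bn: "bracketing_number S \<epsilon> = Inf (enat ` A)"
    unfolding bracketing_number_def A_def ..
  have "A \<noteq> {}"
    using assms unfolding bn by (auto simp: top_enat_def)
  then have "Inf (enat ` A) \<in> enat ` A"
    by (simp add: wellorder_InfI Inf_enat_def) (metis LeastI imageI all_not_in_conv)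
  then obtain n where n: "n \<in> A" "bracketing_number S \<epsilon> = enat n"
    unfolding bn by auto
  then have "real n \<le> c"
    using assms by simp
  then show thesis
    using n(1) that unfolding A_def by blast
qed

text \<open>Split \<open>r *\<^sub>R e\<close> as
  \<open>m *\<^sub>R e + (r - m) *\<^sub>R e\<close>. As \<open>0 \<le> m\<close>, scaling by
  \<open>m\<close> keeps the bracket of \<open>e\<close>; the remainder lies between
  \<open>- h *\<^sub>R d\<close> and \<open>h *\<^sub>R d\<close>.\<close>

lemma scaleR_in_bracket:
  fixes e d l u :: "'a::normed_vector_lattice"
  assumes "l \<le> e" "e \<le> u" "\<bar>e\<bar> \<le> d" "\<bar>r - m\<bar> \<le> h" "0 \<le> m"
  shows "r *\<^sub>R e \<in> {m *\<^sub>R l - h *\<^sub>R d..m *\<^sub>R u + h *\<^sub>R d}"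
proof -
  have e: "e \<le> d" "- e \<le> d"
    using assms(3) by (simp_all add: abs_le_D1 abs_le_D2)
  have "0 \<le> d"
    using assms(3) abs_ge_zero order_trans by blast
  have "\<bar>r - m\<bar> *\<^sub>R d \<le> h *\<^sub>R d"
    using assms(4) \<open>0 \<le> d\<close> by (rule scaleR_right_mono)
  moreover have "(r - m) *\<^sub>R e \<le> \<bar>r - m\<bar> *\<^sub>R d" "- ((r - m) *\<^sub>R e) \<le> \<bar>r - m\<bar> *\<^sub>R d"
    using scaleR_left_mono[OF e(1), of "\<bar>r - m\<bar>"] scaleR_left_mono[OF e(2), of "\<bar>r - m\<bar>"]
    by (cases "r \<ge> m"; simp add: abs_if flip: scaleR_minus_left)+
  ultimately have "(r - m) *\<^sub>R e \<le> h *\<^sub>R d" "- (h *\<^sub>R d) \<le> (r - m) *\<^sub>R e"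
    by (auto intro: order_trans simp: minus_le_iff[of "h *\<^sub>R d"])
  moreover have "m *\<^sub>R l \<le> m *\<^sub>R e" "m *\<^sub>R e \<le> m *\<^sub>R u"
    using assms by (auto intro: scaleR_left_mono)
  moreover have "r *\<^sub>R e = m *\<^sub>R e + (r - m) *\<^sub>R e"
    by (simp add: algebra_simps)
  ultimately show ?thesis
    using add_mono[of "m *\<^sub>R l" "m *\<^sub>R e" "- (h *\<^sub>R d)"] by (auto intro: add_mono)
qed

lemma near_midpoint:
  fixes r \<delta> :: real
  assumes "0 \<le> r" "r \<le> \<delta>" "0 < K"
  obtains k where "k < K" "\<bar>r - (2 * real k + 1) * \<delta> / (2 * real K)\<bar> \<le> \<delta> / (2 * real K)"
proof (cases "r = \<delta>")
  \<comment> \<open>At the right endpoint the floor used below would give the index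
    \<open>K\<close>, one too large, so the last cell is taken. This case also absorbs
    \<open>\<delta> = 0\<close>.\<close>
  case True
  have "\<delta> - (2 * real (K - 1) + 1) * \<delta> / (2 * real K) = \<delta> / (2 * real K)"
    using \<open>0 < K\<close> by (simp add: field_simps of_nat_diff)
  then show thesis
    using True assms by (intro that[of "K - 1"]) auto
next
  case False
  define k where "k = nat \<lfloor>r * K / \<delta>\<rfloor>"
  have pos: "0 < \<delta>" and lt: "r < \<delta>"
    using False assms by auto
  have k: "real k \<le> r * K / \<delta>" "r * K / \<delta> < real k + 1"
    using assms pos unfolding k_def by auto
  have "r * K / \<delta> < K"
    using lt pos \<open>0 < K\<close> by (simp add: field_simps)
  with k have "k < K"
    by linarith
  moreover have "\<bar>r - (2 * real k + 1) * \<delta> / (2 * real K)\<bar> \<le> \<delta> / (2 * real K)"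
    using k pos \<open>0 < K\<close> by (simp add: abs_le_iff field_simps)
  ultimately show thesis
    by (rule that)
qed

lemma bracketing_number_cone_le:
  fixes D S :: "'a::normed_vector_lattice set"
  assumes width: "\<And>i. i \<in> {1..n} \<Longrightarrow> norm (u i - l i) \<le> \<epsilon>"
    and cover: "D \<subseteq> (\<Union>i\<in>{1..n::nat}. {l i..u i})"
    and dom: "\<And>e. e \<in> D \<Longrightarrow> \<bar>e\<bar> \<le> d"
    and cone: "\<And>t. t \<in> S \<Longrightarrow> \<exists>r e. 0 \<le> r \<and> r \<le> \<delta> \<and> e \<in> D \<and> t = t0 + r *\<^sub>R e"
    and "0 < K" "0 \<le> \<delta>" "0 \<le> \<epsilon>"
    and \<rho>: "\<delta> * \<epsilon> + \<delta> / K * norm d \<le> \<rho>"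
  shows "bracketing_number S \<rho> \<le> enat (K * n)"
proof -
  define h where "h = \<delta> / (2 * real K)"
  define m where "m k = (2 * real k + 1) * \<delta> / (2 * real K)" for k
  define L where "L = (\<lambda>(k, i). t0 + (m k *\<^sub>R l i - h *\<^sub>R d))"
  define U where "U = (\<lambda>(k, i). t0 + (m k *\<^sub>R u i + h *\<^sub>R d))"
  have m0: "0 \<le> m k" for k
    using \<open>0 \<le> \<delta>\<close> by (simp add: m_def)
  have m\<delta>: "m k \<le> \<delta>" if "k < K" for k
  proof -
    have "2 * real k + 1 \<le> 2 * real K"
      using that by linarith
    then show ?thesis
      using \<open>0 \<le> \<delta>\<close> \<open>0 < K\<close> mult_right_mono[of "2 * real k + 1" "2 * real K" \<delta>]
      by (simp add: m_def field_simps)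
  qed
  have "norm (U p - L p) \<le> \<rho>" if "p \<in> {..<K} \<times> {1..n}" for p
  proof -
    obtain k i where p: "p = (k, i)" "k < K" "i \<in> {1..n}"
      using \<open>p \<in> _\<close> by auto
    \<comment> \<open>The base point cancels and the two margins \<open>h *\<^sub>R d\<close> add up
      to one full cell length, \<open>2 * h = \<delta> / K\<close>.\<close>
    have "U p - L p = m k *\<^sub>R (u i - l i) + (2 * h) *\<^sub>R d"
      unfolding p(1) U_def L_def by (simp add: algebra_simps flip: scaleR_2)
    then have "norm (U p - L p) \<le> m k * norm (u i - l i) + \<bar>2 * h\<bar> * norm d"
      using m0[of k] by (metis norm_triangle_ineq norm_scaleR abs_of_nonneg)
    also have "\<dots> \<le> \<delta> * \<epsilon> + \<delta> / K * norm d"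
      using width[OF p(3)] m0[of k] m\<delta>[OF p(2)] \<open>0 \<le> \<delta>\<close> by (auto simp: h_def intro!: mult_mono)
    finally show ?thesis
      using \<rho> by linarith
  qed
  moreover have "S \<subseteq> (\<Union>p\<in>{..<K} \<times> {1..n}. {L p..U p})"
  proof
    fix t assume "t \<in> S"
    then obtain r e where re: "0 \<le> r" "r \<le> \<delta>" "e \<in> D" "t = t0 + r *\<^sub>R e"
      using cone by blast
    obtain i where i: "i \<in> {1..n}" "l i \<le> e" "e \<le> u i"
      using cover \<open>e \<in> D\<close> by fastforce
    obtain k where k: "k < K" "\<bar>r - m k\<bar> \<le> h"
      using near_midpoint[OF re(1,2) \<open>0 < K\<close>] unfolding m_def h_def by blast
    have "r *\<^sub>R e \<in> {m k *\<^sub>R l i - h *\<^sub>R d..m k *\<^sub>R u i + h *\<^sub>R d}"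
      using i(2,3) dom[OF re(3)] k(2) m0 by (rule scaleR_in_bracket)
    then have "t \<in> {L (k, i)..U (k, i)}"
      unfolding L_def U_def re(4) by (simp only: atLeastAtMost_iff prod.case add_le_cancel_left)
    then show "t \<in> (\<Union>p\<in>{..<K} \<times> {1..n}. {L p..U p})"
      using k(1) i(1) by blast
  qed
  ultimately have "bracketing_number S \<rho> \<le> enat (card ({..<K} \<times> {1..n}))"
    by (intro bracketing_number_le_card) auto
  then show ?thesis
    by (simp add: card_cartesian_product)
qed

text \<open>Here \<open>x\<close> is the number of radial cells before rounding and \<open>y\<close>
  the base of the bound for the directions. Rounding costs a factor 2 since \<open>1 < x\<close>.
  For \<open>y \<le> A / 4\<close> the power gains a factor 4, as \<open>4 powr q \<ge> 4\<close>.
  Otherwise \<open>y \<le> A / x\<close>, and \<open>x powr q \<ge> x\<close> cancels the factor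
  \<open>x\<close>, leaving \<open>2 \<le> A\<close> to finish.\<close>

lemma grid_count_le_powr:
  fixes x A y q :: real
  assumes "1 < x" "x \<le> A" "2 \<le> A" "0 < y" "1 \<le> q" and y: "y \<le> A / 4 \<or> x * y \<le> A"
  shows "real (nat \<lceil>x\<rceil>) * y powr q \<le> A powr (q + 1)"
proof -
  have K: "real (nat \<lceil>x\<rceil>) \<le> 2 * x"
    using \<open>1 < x\<close> by linarith
  have scale: "(A / c) powr q \<le> A powr q / c" if "1 \<le> c" for c
  proof -
    have "c powr 1 \<le> c powr q"
      using that \<open>1 \<le> q\<close> by (intro powr_mono) auto
    then show ?thesis
      using that \<open>2 \<le> A\<close> by (auto simp: powr_divide intro!: divide_left_mono)
  qed
  have "2 * x * y powr q \<le> A powr q * A"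
    using y
  proof
    assume "y \<le> A / 4"
    then have "y powr q \<le> A powr q / 4"
      using scale[of 4] powr_mono2[of q y "A / 4"] \<open>0 < y\<close> \<open>1 \<le> q\<close> by linarith
    then have "2 * x * y powr q \<le> 2 * A * (A powr q / 4)"
      using assms by (intro mult_mono) auto
    also have "\<dots> \<le> A powr q * A"
      using \<open>2 \<le> A\<close> by simp
    finally show ?thesis .
  next
    assume "x * y \<le> A"
    then have "y \<le> A / x"
      using \<open>1 < x\<close> by (simp add: field_simps)
    then have "y powr q \<le> A powr q / x"
      using scale[of x] powr_mono2[of q y "A / x"] assms by linarith
    then have "2 * x * y powr q \<le> 2 * x * (A powr q / x)"
      using \<open>1 < x\<close> by (intro mult_left_mono) auto
    also have "\<dots> = A powr q * 2"
      using \<open>1 < x\<close> by simp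
    also have "\<dots> \<le> A powr q * A"
      using \<open>2 \<le> A\<close> by (intro mult_left_mono) auto
    finally show ?thesis .
  qed
  moreover have "real (nat \<lceil>x\<rceil>) * y powr q \<le> 2 * x * y powr q"
    using K by (intro mult_right_mono) auto
  ultimately show ?thesis
    using \<open>2 \<le> A\<close> by (simp add: powr_add)
qed

theorem theorem2p2:
  fixes T :: "'a::normed_vector_lattice set" and t0 d :: 'a and q C0 \<epsilon>0 \<delta> \<rho> :: real
  assumes "t0 \<in> T"
    and "q \<ge> 1" and "C0 \<ge> 1" and "\<epsilon>0 > 0"
    and "\<And>\<epsilon>. 0 < \<epsilon> \<Longrightarrow> \<epsilon> \<le> \<epsilon>0 \<Longrightarrow>
           ereal_of_enat (bracketing_number (direction t0 ` (T - {t0})) \<epsilon>) \<le> ereal ((C0 / \<epsilon>) powr q)"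
    and "\<And>t. t \<in> T \<Longrightarrow> t \<noteq> t0 \<Longrightarrow> \<bar>direction t0 t\<bar> \<le> d"
    and "\<delta> > 0" and "\<rho> > 0" and "\<rho> / \<delta> < min 4 (2 * norm d)"
  shows "ereal_of_enat (bracketing_number (T \<inter> cball t0 \<delta>) \<rho>)
           \<le> ereal ((8 * (C0 * max 1 (norm d / (4 * \<epsilon>0))) * \<delta> / \<rho>) powr (q + 1))"
proof -
  define D where "D = direction t0 ` (T - {t0})"
  define C where "C = C0 * max 1 (norm d / (4 * \<epsilon>0))"
  define A where "A = 8 * C * \<delta> / \<rho>"
  define x where "x = 2 * \<delta> * norm d / \<rho>"
  have C: "C0 \<le> C" "C0 * (norm d / (4 * \<epsilon>0)) \<le> C"
    using \<open>C0 \<ge> 1\<close> mult_left_mono[of 1 "max 1 (norm d / (4 * \<epsilon>0))" C0]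
    unfolding C_def by (simp, intro mult_left_mono) auto
  \<comment> \<open>The two entries of the minimum bounding \<open>\<rho> / \<delta>\<close> are
    used separately: \<open>2 * norm d\<close> gives \<open>1 < x\<close>, and 4 gives
    \<open>2 \<le> A\<close>.\<close>
  have "1 < x"
    using assms(7-9) by (simp add: x_def field_simps)
  have "\<rho> < 4 * \<delta>"
    using assms(7-9) by (simp add: field_simps)
  moreover have "8 * \<delta> * 1 \<le> 8 * \<delta> * C"
    using \<open>C0 \<ge> 1\<close> C(1) \<open>\<delta> > 0\<close> by (intro mult_left_mono) auto
  ultimately have "2 * \<rho> \<le> 8 * \<delta> * C"
    by linarith
  then have "2 \<le> A"
    using \<open>\<rho> > 0\<close> by (simp add: A_def field_simps)
  have "ereal_of_enat (bracketing_number (T \<inter> cball t0 \<delta>) \<rho>) \<le> ereal (A powr (q + 1))"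
  proof (cases "D = {}")
    \<comment> \<open>Without directions the covering hypothesis carries no information, but the set
      to cover is \<open>{t0}\<close>: one degenerate bracket suffices, and the bound is at least
      1.\<close>
    case True
    then have "T = {t0}"
      using \<open>t0 \<in> T\<close> unfolding D_def by auto
    then have "bracketing_number (T \<inter> cball t0 \<delta>) \<rho> \<le> enat (card {()})"
      using \<open>\<rho> > 0\<close> by (intro bracketing_number_le_card[where u = "\<lambda>_. t0" and l = "\<lambda>_. t0"]) auto
    then have "ereal_of_enat (bracketing_number (T \<inter> cball t0 \<delta>) \<rho>) \<le> ereal_of_enat (enat 1)"
      by (subst ereal_of_enat_le_iff) simp
    also have "\<dots> \<le> ereal (A powr (q + 1))"
      using \<open>2 \<le> A\<close> \<open>q \<ge> 1\<close> ge_one_powr_ge_zero[of A "q + 1"] by simp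
    finally show ?thesis .
  next
    case False
    have "\<epsilon>0 \<le> C0"
    proof -
      obtain n l u where n: "real n \<le> (C0 / \<epsilon>0) powr q" "D \<subseteq> (\<Union>i\<in>{1..n}. {l i..u i :: 'a})"
        using bracketing_number_leE[OF assms(5)[OF \<open>\<epsilon>0 > 0\<close> order_refl]] unfolding D_def by metis
      then have "n \<noteq> 0"
        using False by auto
      show ?thesis
      \<comment> \<open>If \<open>C0 < \<epsilon>0\<close>, the bound would be below 1 and force
        \<open>n = 0\<close>.\<close>
      proof (rule ccontr)
        assume "\<not> \<epsilon>0 \<le> C0"
        then have "(C0 / \<epsilon>0) powr q < 1 powr q"
          using assms(2-4) by (intro powr_less_mono2) auto
        then show False
          using n(1) \<open>n \<noteq> 0\<close> by simp
      qed
    qed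
    \<comment> \<open>Each error source gets \<open>\<rho> / 2\<close>: directions through
      \<open>\<delta> * \<epsilon>\<close>, radii through \<open>\<delta> / K * norm d\<close> with
      \<open>K \<ge> x\<close>. The cap \<open>\<epsilon>0\<close> keeps the hypothesis
      applicable.\<close>
    define \<epsilon> where "\<epsilon> = min (\<rho> / (2 * \<delta>)) \<epsilon>0"
    have \<epsilon>: "0 < \<epsilon>" "\<epsilon> \<le> \<epsilon>0" "\<epsilon> \<le> \<rho> / (2 * \<delta>)"
      using assms by (auto simp: \<epsilon>_def)
    obtain n and l u :: "nat \<Rightarrow> 'a" where n: "real n \<le> (C0 / \<epsilon>) powr q"
      and width: "\<And>i. i \<in> {1..n} \<Longrightarrow> norm (u i - l i) \<le> \<epsilon>"
      and cover: "D \<subseteq> (\<Union>i\<in>{1..n}. {l i..u i})"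
      using bracketing_number_leE[OF assms(5)[OF \<epsilon>(1,2)]] unfolding D_def by metis
    define K where "K = nat \<lceil>x\<rceil>"
    have K: "0 < K" "x \<le> K"
      using \<open>1 < x\<close> unfolding K_def by linarith+
    have "bracketing_number (T \<inter> cball t0 \<delta>) \<rho> \<le> enat (K * n)"
    proof (rule bracketing_number_cone_le[OF width cover])
      show "\<bar>e\<bar> \<le> d" if "e \<in> D" for e
        using that assms(6) unfolding D_def by auto
      show "\<exists>r e. 0 \<le> r \<and> r \<le> \<delta> \<and> e \<in> D \<and> t = t0 + r *\<^sub>R e" if "t \<in> T \<inter> cball t0 \<delta>" for t
      proof (cases "t = t0")
        \<comment> \<open>The point \<open>t0\<close> has no direction of its own in
          \<open>D\<close>; radius 0 along any element of \<open>D\<close> represents it.\<close>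
        case True
        then show ?thesis
          using \<open>D \<noteq> {}\<close> \<open>\<delta> > 0\<close> by (intro exI[of _ "0::real"]) auto
      next
        case False
        then have "direction t0 t \<in> D" "t = t0 + norm (t - t0) *\<^sub>R direction t0 t"
          using that by (auto simp: D_def direction_def)
        moreover have "norm (t - t0) \<le> \<delta>"
          using that by (simp add: dist_norm norm_minus_commute)
        ultimately show ?thesis
          using norm_ge_zero by blast
      qed
      have "\<delta> * \<epsilon> \<le> \<rho> / 2"
        using \<epsilon>(3) \<open>\<delta> > 0\<close> by (simp add: field_simps)
      moreover have "\<delta> / K * norm d \<le> \<rho> / 2"
        using K \<open>\<rho> > 0\<close> by (simp add: x_def field_simps)
      ultimately show "\<delta> * \<epsilon> + \<delta> / K * norm d \<le> \<rho>"
        by linarith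
    qed (use K \<epsilon> \<open>\<delta> > 0\<close> in auto)
    then have "ereal_of_enat (bracketing_number (T \<inter> cball t0 \<delta>) \<rho>) \<le> ereal_of_enat (enat (K * n))"
      by (subst ereal_of_enat_le_iff)
    also have "\<dots> \<le> ereal (K * (C0 / \<epsilon>) powr q)"
      using n by (simp add: mult_left_mono)
    also have "\<dots> \<le> ereal (A powr (q + 1))"
      unfolding K_def ereal_less_eq
    proof (rule grid_count_le_powr)
      \<comment> \<open>The right side is \<open>C0\<close> times the second entry of the maximum in
        \<open>C\<close>, hence at most \<open>C\<close>.\<close>
      have "1 * (norm d / 4) \<le> C0 / \<epsilon>0 * (norm d / 4)"
        using \<open>\<epsilon>0 \<le> C0\<close> \<open>\<epsilon>0 > 0\<close> by (intro mult_right_mono) auto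
      then have "norm d \<le> 4 * C"
        using C(2) by simp
      then have "2 * \<delta> * norm d \<le> 2 * \<delta> * (4 * C)"
        using \<open>\<delta> > 0\<close> by (intro mult_left_mono) auto
      then show "x \<le> A"
        using \<open>\<rho> > 0\<close> by (simp add: x_def A_def divide_right_mono mult_ac)
      \<comment> \<open>The alternatives match the two values of \<open>\<epsilon>\<close>: for
        \<open>\<rho> / (2 * \<delta>)\<close> the entry 1 of the maximum in \<open>C\<close> is
        enough, for \<open>\<epsilon>0\<close> the entry \<open>norm d / (4 * \<epsilon>0)\<close>
        is what bounds the product.\<close>
      show "C0 / \<epsilon> \<le> A / 4 \<or> x * (C0 / \<epsilon>) \<le> A"
      proof (cases "\<rho> / (2 * \<delta>) \<le> \<epsilon>0")
        case True
        then have "C0 / \<epsilon> = 2 * \<delta> / \<rho> * C0"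
          by (simp add: \<epsilon>_def)
        also have "\<dots> \<le> 2 * \<delta> / \<rho> * C"
          using C(1) assms(7,8) by (intro mult_left_mono) auto
        finally show ?thesis
          by (simp add: A_def mult_ac)
      next
        case False
        then have "x * (C0 / \<epsilon>) = 8 * \<delta> / \<rho> * (C0 * (norm d / (4 * \<epsilon>0)))"
          by (simp add: \<epsilon>_def x_def mult_ac)
        also have "\<dots> \<le> 8 * \<delta> / \<rho> * C"
          using C(2) assms(7,8) by (intro mult_left_mono) auto
        finally show ?thesis
          by (simp add: A_def mult_ac)
      qed
    qed (use \<open>1 < x\<close> \<open>2 \<le> A\<close> assms(2,3) \<epsilon>(1) in auto)
    finally show ?thesis .
  qed
  then show ?thesis
    unfolding A_def C_def .
qed

end
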